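(* Let $\tau$ be a fixed positive integer and let $T\ge1$ be such that $K=T/\tau$ is an integer. Consider the zero-mean Gaussian process $f$ on $\mathcal A\times\{1,2,\dots\}$ with kernel $k\{(\boldsymbol a,t),(\boldsymbol a',t')\}=k_{\mathcal A}(\boldsymbol a,\boldsymbol a')k_\tau(t,t')$ described in the context, with rewards $y_t=f(\boldsymbol a_t,t)+\epsilon_t$ received at inputs $\boldsymbol s_t=(\boldsymbol a_t,t)$, $1\le t\le T$, where the noise variables $\epsilon_t$ are drawn independently across $t$ from $N(0,\sigma^2)$. Then the maximum mutual information gain $\gamma^{\mathcal S}_T$ satisfies $$\gamma^{\mathcal S}_T\le\sum_{i=1}^{\tau}\gamma^{\mathcal A}_{T/\tau}=\tau\,\gamma^{\mathcal A}_{K}.$$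
   Context: $\mathcal A$ is an action space, $k_{\mathcal A}$ is a positive semidefinite kernel on $\mathcal A$, and $$k_\tau(t,t')=\exp\Big[-\frac{2}{l^2}\sin^2\Big\{\frac{\pi|t-t'|}{\tau}\Big\}\Big]$$ is the periodic kernel on times $t,t'\in\{1,2,\dots\}$, with length scale $l>0$ and period $\tau$. The kernel $k$ is bounded: $k\le 1$. The noise variance $\sigma^2>0$ is known and the noise is independent of $f$. Maximum information gain on action-time pairs: $$\gamma^{\mathcal S}_T=\max_{\boldsymbol a_1,\dots,\boldsymbol a_T\in\mathcal A}\frac12\log\big|\boldsymbol I_T+\sigma^{-2}\boldsymbol K_S\big|,\qquad \boldsymbol K_S=\big[k_{\mathcal A}(\boldsymbol a_i,\boldsymbol a_j)k_\tau(i,j)\big]_{1\le i,j\le T}.$$ It equals the maximum over fixed actions of the mutual information $I(\boldsymbol y_{1:T};\boldsymbol f_{1:T})$, $\boldsymbol f_{1:T}=(f(\boldsymbol a_t,t))_{t\le T}$. Maximum information gain on actions alone (stationary reward $f_0\sim$ zero-mean GP with kernel $k_{\mathcal A}$): $$\gamma^{\mathcal A}_n=\max_{\boldsymbol a_1,\dots,\boldsymbol a_n\in\mathcal A}\frac12\log\big|\boldsymbol I_n+\sigma^{-2}\boldsymbol K_A\big|,\qquad \boldsymbol K_A=\big[k_{\mathcal A}(\boldsymbol a_i,\boldsymbol a_j)\big]_{1\le i,j\le n}.$$ Maxima are suprema if not attained; repeated actions are allowed. *)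

theory Defs
  imports "HOL-Probability.Probability" "Jordan_Normal_Form.Determinant"
begin

definition psd_kernel_on :: "'a set \<Rightarrow> ('a \<Rightarrow> 'a \<Rightarrow> real) \<Rightarrow> bool" where
  "psd_kernel_on A k \<longleftrightarrow>
     (\<forall>x\<in>A. \<forall>y\<in>A. k x y = k y x) \<and>
     (\<forall>(n::nat) (x :: nat \<Rightarrow> 'a) (c :: nat \<Rightarrow> real). (\<forall>i<n. x i \<in> A) \<longrightarrow>
        0 \<le> (\<Sum>i<n. \<Sum>j<n. c i * c j * k (x i) (x j)))"

definition periodic_kernel :: "real \<Rightarrow> nat \<Rightarrow> nat \<Rightarrow> nat \<Rightarrow> real" where
  "periodic_kernel l \<tau> t t' =
     exp (- (2 / l\<^sup>2) * (sin (pi * \<bar>real t - real t'\<bar> / real \<tau>))\<^sup>2)"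

definition action_time_kernel ::
  "('a \<Rightarrow> 'a \<Rightarrow> real) \<Rightarrow> real \<Rightarrow> nat \<Rightarrow> 'a \<times> nat \<Rightarrow> 'a \<times> nat \<Rightarrow> real" where
  "action_time_kernel kA l \<tau> s s' =
     kA (fst s) (fst s') * periodic_kernel l \<tau> (snd s) (snd s')"

(* Point masses count as normal laws, so that kernels with singular
   Gram matrices are covered. *)
definition normal_law :: "real \<Rightarrow> real \<Rightarrow> real measure" where
  "normal_law \<mu> \<sigma> =
     (if \<sigma> = 0 then return borel \<mu> else density lborel (normal_density \<mu> \<sigma>))"

definition zero_mean_gaussian_process ::
  "'w measure \<Rightarrow> 's set \<Rightarrow> ('s \<Rightarrow> 'w \<Rightarrow> real) \<Rightarrow> ('s \<Rightarrow> 's \<Rightarrow> real) \<Rightarrow> bool" where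
  "zero_mean_gaussian_process M S f k \<longleftrightarrow>
     prob_space M \<and>
     (\<forall>s\<in>S. f s \<in> borel_measurable M) \<and>
     (\<forall>F c. finite F \<and> F \<subseteq> S \<longrightarrow>
        (\<exists>\<mu> \<sigma>. \<sigma> \<ge> 0 \<and> distr M borel (\<lambda>\<omega>. \<Sum>s\<in>F. c s * f s \<omega>) = normal_law \<mu> \<sigma>)) \<and>
     (\<forall>s\<in>S. (\<integral>\<omega>. f s \<omega> \<partial>M) = 0) \<and>
     (\<forall>s\<in>S. \<forall>s'\<in>S. (\<integral>\<omega>. f s \<omega> * f s' \<omega> \<partial>M) = k s s')"

(* Rows and columns of matrices are numbered from 0 and inputs from 1, hence Suc. *)
definition kernel_matrix :: "nat \<Rightarrow> ('s \<Rightarrow> 's \<Rightarrow> real) \<Rightarrow> (nat \<Rightarrow> 's) \<Rightarrow> real mat" where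
  "kernel_matrix n k s = mat n n (\<lambda>(i, j). k (s (Suc i)) (s (Suc j)))"

definition info_gain :: "real \<Rightarrow> nat \<Rightarrow> ('s \<Rightarrow> 's \<Rightarrow> real) \<Rightarrow> (nat \<Rightarrow> 's) \<Rightarrow> real" where
  "info_gain \<sigma> n k s =
     1 / 2 * ln (Determinant.det (1\<^sub>m n + inverse (\<sigma>\<^sup>2) \<cdot>\<^sub>m kernel_matrix n k s))"

(* The two suprema are over nonempty sets that are bounded above whenever A is
   nonempty and the kernel is positive semidefinite and bounded on A. *)
definition max_info_gain_actions ::
  "'a set \<Rightarrow> ('a \<Rightarrow> 'a \<Rightarrow> real) \<Rightarrow> real \<Rightarrow> nat \<Rightarrow> real" where
  "max_info_gain_actions A kA \<sigma> n =
     (SUP a \<in> {a. \<forall>i\<in>{1..n}. a i \<in> A}. info_gain \<sigma> n kA a)"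

definition max_info_gain_action_time ::
  "'a set \<Rightarrow> ('a \<Rightarrow> 'a \<Rightarrow> real) \<Rightarrow> real \<Rightarrow> nat \<Rightarrow> real \<Rightarrow> nat \<Rightarrow> real" where
  "max_info_gain_action_time A kA l \<tau> \<sigma> T =
     (SUP a \<in> {a. \<forall>t\<in>{1..T}. a t \<in> A}.
        info_gain \<sigma> T (action_time_kernel kA l \<tau>) (\<lambda>t. (a t, t)))"

end

theory Submission imports Defs begin

text \<open>The times in one residue class modulo \<open>\<tau>\<close> have periodic correlation 1, so the corresponding
  principal block of \<open>I + \<sigma>\<^sup>-\<^sup>2 K\<^sub>S\<close> is a matrix \<open>I + \<sigma>\<^sup>-\<^sup>2 K\<^sub>A\<close> of size \<open>K\<close>. Fischer's inequality bounds the
  determinant by the product of these \<open>\<tau>\<close> blocks. It holds because adjoining an index multiplies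
  the determinant by the least mean squared error of predicting the new variable from the old
  ones, and this error can only grow when fewer variables are available.\<close>

section \<open>Gram determinants when a point is appended\<close>

text \<open>With lists, adjoining a point is an append and passing to a principal submatrix is a
  \<open>filter\<close>.\<close>

definition gram :: "('a \<Rightarrow> 'a \<Rightarrow> real) \<Rightarrow> 'a list \<Rightarrow> real mat" where
  "gram k xs = mat (length xs) (length xs) (\<lambda>(i, j). k (xs ! i) (xs ! j))"

lemma gram_carrier [simp]: "gram k xs \<in> carrier_mat (length xs) (length xs)"
  by (simp add: gram_def)

lemma gram_map: "gram k (map f xs) = gram (\<lambda>x y. k (f x) (f y)) xs"
  by (rule eq_matI) (auto simp: gram_def)

lemma det_gram_Nil [simp]: "Determinant.det (gram k []) = 1"
  by (simp add: gram_def)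

lemma det_gram_singleton [simp]: "Determinant.det (gram k [x]) = k x x"
  by (subst det_single) (auto simp: gram_def)

text \<open>The new factor is a Schur complement. The weights \<open>w\<close> solve the linear
  system whose right-hand side is the upper part of the last column; subtracting the first columns
  with these weights clears that part.\<close>

lemma det_gram_snoc_index:
  fixes k :: "'a \<Rightarrow> 'a \<Rightarrow> real"
  assumes nz: "Determinant.det (gram k xs) \<noteq> 0"
  obtains w where
    "\<And>i. i < length xs \<Longrightarrow> (\<Sum>j<length xs. k (xs ! i) (xs ! j) * w j) = k (xs ! i) x"
    "Determinant.det (gram k (xs @ [x])) =
       Determinant.det (gram k xs) * (k x x - (\<Sum>j<length xs. k x (xs ! j) * w j))"
proof -
  define n where "n = length xs"
  define G where "G = gram k xs"
  have G: "G \<in> carrier_mat n n" by (simp add: G_def n_def)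
  from det_non_zero_imp_unit[OF G, of "()"] nz
  obtain B where GB: "G * B = 1\<^sub>m n" and B: "B \<in> carrier_mat n n"
    unfolding Units_def ring_mat_def G_def by auto
  define b where "b = mat n 1 (\<lambda>(i, _). k (xs ! i) x)"
  define W where "W = B * b"
  have b: "b \<in> carrier_mat n 1" by (simp add: b_def)
  have W: "W \<in> carrier_mat n 1" using B b by (simp add: W_def)
  have GW: "G * W = b"
    unfolding W_def using assoc_mult_mat[OF G B b] GB b by simp
  define w where "w j = W $$ (j, 0)" for j
  have eq: "(\<Sum>j<n. k (xs ! i) (xs ! j) * w j) = k (xs ! i) x" if "i < n" for i
  proof -
    have "(G * W) $$ (i, 0) = (\<Sum>j<n. k (xs ! i) (xs ! j) * w j)"
      using that G W
      by (simp add: scalar_prod_def w_def G_def gram_def n_def atLeast0LessThan)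
    then show ?thesis using that by (simp add: GW b_def)
  qed
  define c where "c = mat 1 n (\<lambda>(_, j). k x (xs ! j))"
  define d where "d = mat 1 1 (\<lambda>(_, _). k x x)"
  have c: "c \<in> carrier_mat 1 n" and d: "d \<in> carrier_mat 1 1" by (simp_all add: c_def d_def)
  have blocks: "gram k (xs @ [x]) = four_block_mat G b c d"
    by (rule eq_matI) (auto simp: gram_def G_def b_def c_def d_def n_def nth_append less_Suc_eq)
  \<comment> \<open>Right multiplication by \<open>U\<close> performs this column operation.
    \<open>U\<close> is unitriangular, so the determinant does not change.\<close>
  define U where "U = four_block_mat (1\<^sub>m n) (- W) (0\<^sub>m 1 n) (1\<^sub>m 1)"
  have U: "U \<in> carrier_mat (n + 1) (n + 1)" unfolding U_def by (rule four_block_carrier_mat) simp_all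
  have "Determinant.det U = Determinant.det (1\<^sub>m n :: real mat) * Determinant.det (1\<^sub>m 1 :: real mat)"
    unfolding U_def using W by (intro det_four_block_mat_lower_left_zero) auto
  then have detU: "Determinant.det U = 1" by simp
  define e where "e = c * (- W) + d"
  have e: "e \<in> carrier_mat 1 1" using c d W by (simp add: e_def)
  have e00: "e $$ (0, 0) = k x x - (\<Sum>j<n. k x (xs ! j) * w j)"
    using c d W
    by (simp add: e_def scalar_prod_def w_def c_def d_def atLeast0LessThan sum_negf)
  have "G * (- W) = - b" using G W GW by simp
  then have "G * (- W) + b * 1\<^sub>m 1 = 0\<^sub>m n 1" using uminus_l_inv_mat[OF b] b by simp
  moreover have "G * 1\<^sub>m n + b * 0\<^sub>m 1 n = G" "c * 1\<^sub>m n + d * 0\<^sub>m 1 n = c"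
      "c * (- W) + d * 1\<^sub>m 1 = e"
    using G b c d by (simp_all add: e_def)
  ultimately have "four_block_mat G b c d * U = four_block_mat G (0\<^sub>m n 1) c e"
    unfolding U_def
    using mult_four_block_mat[OF G b c d one_carrier_mat uminus_carrier_mat[OF W]
        zero_carrier_mat one_carrier_mat] by simp
  then have "Determinant.det (four_block_mat G b c d * U) = Determinant.det G * Determinant.det e"
    using det_four_block_mat_upper_right_zero[OF G refl c e] by simp
  moreover have "Determinant.det (four_block_mat G b c d * U) = Determinant.det (four_block_mat G b c d)"
    using det_mult[OF four_block_carrier_mat[OF G d] U] detU by simp
  moreover have "Determinant.det e = e $$ (0, 0)" by (rule det_single[OF e])
  ultimately have "Determinant.det (gram k (xs @ [x])) =
      Determinant.det (gram k xs) * (k x x - (\<Sum>j<n. k x (xs ! j) * w j))"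
    by (simp add: blocks e00 G_def)
  with eq show thesis by (intro that[of w]) (simp_all add: n_def)
qed

text \<open>The weights move from positions to points, so that lists can be compared through their
  sets. Distinctness makes positions and points correspond one to one.\<close>

lemma det_gram_snoc:
  fixes k :: "'a \<Rightarrow> 'a \<Rightarrow> real"
  assumes nz: "Determinant.det (gram k xs) \<noteq> 0" and dist: "distinct xs"
  obtains w where
    "\<And>y. y \<in> set xs \<Longrightarrow> (\<Sum>z\<in>set xs. k y z * w z) = k y x"
    "Determinant.det (gram k (xs @ [x])) =
       Determinant.det (gram k xs) * (k x x - (\<Sum>z\<in>set xs. k x z * w z))"
proof -
  from det_gram_snoc_index[OF nz, of x] obtain v where
    v: "\<And>i. i < length xs \<Longrightarrow> (\<Sum>j<length xs. k (xs ! i) (xs ! j) * v j) = k (xs ! i) x"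
    "Determinant.det (gram k (xs @ [x])) =
       Determinant.det (gram k xs) * (k x x - (\<Sum>j<length xs. k x (xs ! j) * v j))"
    by blast
  have bij: "bij_betw ((!) xs) {..<length xs} (set xs)"
    by (rule bij_betw_nth[OF dist refl refl])
  define w where "w z = v (the_inv_into {..<length xs} ((!) xs) z)" for z
  have "(\<Sum>j<length xs. k y (xs ! j) * v j) = (\<Sum>z\<in>set xs. k y z * w z)" for y
    unfolding sum.reindex_bij_betw[OF bij, symmetric] w_def
    using bij by (intro sum.cong) (auto simp: the_inv_into_f_f bij_betw_def)
  with v show thesis
    by (intro that[of w]) (auto simp: in_set_conv_nth)
qed

section \<open>Positive definite kernels and least squares prediction\<close>

definition positive_definite_on :: "'a set \<Rightarrow> ('a \<Rightarrow> 'a \<Rightarrow> real) \<Rightarrow> bool" where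
  "positive_definite_on I k \<longleftrightarrow>
     (\<forall>x\<in>I. \<forall>y\<in>I. k x y = k y x) \<and>
     (\<forall>S c. finite S \<and> S \<subseteq> I \<and> (\<exists>x\<in>S. c x \<noteq> 0) \<longrightarrow> 0 < (\<Sum>x\<in>S. \<Sum>y\<in>S. c x * c y * k x y))"

text \<open>The mean squared error of predicting a variable at \<open>x\<close> by the linear combination
  with weights \<open>c\<close> of the variables at \<open>S\<close>, when \<open>k\<close> is their covariance.\<close>

definition prediction_error :: "('a \<Rightarrow> 'a \<Rightarrow> real) \<Rightarrow> 'a set \<Rightarrow> 'a \<Rightarrow> ('a \<Rightarrow> real) \<Rightarrow> real" where
  "prediction_error k S x c =
     k x x - 2 * (\<Sum>y\<in>S. c y * k x y) + (\<Sum>y\<in>S. \<Sum>z\<in>S. c y * c z * k y z)"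

text \<open>The error is the quadratic form at the vector that equals \<open>c\<close> on
  \<open>S\<close> and -1 at \<open>x\<close>, hence at a nonzero vector.\<close>

lemma prediction_error_pos:
  assumes pd: "positive_definite_on I k" and S: "finite S" "insert x S \<subseteq> I" "x \<notin> S"
  shows "0 < prediction_error k S x c"
proof -
  define e where "e = (\<lambda>y. if y = x then - 1 else c y)"
  have sym: "k y x = k x y" if "y \<in> S" for y
    using pd S that unfolding positive_definite_on_def by auto
  have "0 < (\<Sum>y\<in>insert x S. \<Sum>z\<in>insert x S. e y * e z * k y z)"
    using pd S unfolding positive_definite_on_def
    by (auto simp: e_def simp del: sum.insert dest!: spec[of _ "insert x S"])
  also have "\<dots> = k x x - (\<Sum>y\<in>S. c y * k x y) + (\<Sum>y\<in>S. - c y * k y x + (\<Sum>z\<in>S. c y * c z * k y z))"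
  proof -
    have [simp]: "e x = -1" "\<And>y. y \<in> S \<Longrightarrow> e y = c y" using S by (auto simp: e_def)
    show ?thesis using S by (simp add: sum_negf cong: sum.cong)
  qed
  also have "\<dots> = prediction_error k S x c"
    using sym by (simp add: prediction_error_def sum.distrib sum_subtractf sum_negf cong: sum.cong)
  finally show ?thesis .
qed

text \<open>The condition on \<open>w\<close> is the system of normal equations. It makes the
  residual orthogonal to the variables at \<open>S\<close>, so replacing \<open>w\<close> by
  \<open>c\<close> adds the quadratic form of \<open>c - w\<close>, as in Pythagoras.\<close>

lemma prediction_error_minimum:
  assumes pd: "positive_definite_on I k" and S: "finite S" "insert x S \<subseteq> I"
    and w: "\<And>y. y \<in> S \<Longrightarrow> (\<Sum>z\<in>S. k y z * w z) = k y x"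
  shows "prediction_error k S x w = k x x - (\<Sum>z\<in>S. k x z * w z)"
    and "prediction_error k S x w \<le> prediction_error k S x c"
proof -
  have sym: "k y z = k z y" if "y \<in> insert x S" "z \<in> insert x S" for y z
    using pd S that unfolding positive_definite_on_def by blast
  have cross: "(\<Sum>y\<in>S. \<Sum>z\<in>S. e y * w z * k y z) = (\<Sum>y\<in>S. e y * k x y)" for e
  proof (rule sum.cong[OF refl])
    fix y assume y: "y \<in> S"
    have "(\<Sum>z\<in>S. e y * w z * k y z) = e y * (\<Sum>z\<in>S. k y z * w z)"
      by (simp add: sum_distrib_left mult_ac)
    then show "(\<Sum>z\<in>S. e y * w z * k y z) = e y * k x y"
      using w[OF y] sym y by simp
  qed
  have cross': "(\<Sum>y\<in>S. \<Sum>z\<in>S. w y * e z * k y z) = (\<Sum>y\<in>S. e y * k x y)" for e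
  proof -
    have "(\<Sum>y\<in>S. \<Sum>z\<in>S. w y * e z * k y z) = (\<Sum>z\<in>S. \<Sum>y\<in>S. w y * e z * k y z)"
      by (rule sum.swap)
    also have "\<dots> = (\<Sum>z\<in>S. \<Sum>y\<in>S. e z * w y * k z y)"
      using sym by (intro sum.cong) (auto simp: mult_ac)
    finally show ?thesis by (simp add: cross)
  qed
  show "prediction_error k S x w = k x x - (\<Sum>z\<in>S. k x z * w z)"
    unfolding prediction_error_def cross by (simp add: mult.commute)
  have "0 \<le> (\<Sum>y\<in>S. \<Sum>z\<in>S. (c y - w y) * (c z - w z) * k y z)"
  \<comment> \<open>Definiteness speaks only of coefficients that are not all zero; otherwise the
    form is 0.\<close>
  proof (cases "\<exists>y\<in>S. c y - w y \<noteq> 0")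
    case True
    then show ?thesis using pd S unfolding positive_definite_on_def
      by (intro less_imp_le) (auto dest!: spec[of _ S])
  qed simp
  also have "\<dots> = (\<Sum>y\<in>S. \<Sum>z\<in>S. c y * c z * k y z) - (\<Sum>y\<in>S. \<Sum>z\<in>S. c y * w z * k y z)
      - (\<Sum>y\<in>S. \<Sum>z\<in>S. w y * c z * k y z) + (\<Sum>y\<in>S. \<Sum>z\<in>S. w y * w z * k y z)"
    by (simp add: algebra_simps sum.distrib sum_subtractf)
  also have "\<dots> = prediction_error k S x c - prediction_error k S x w"
    unfolding prediction_error_def cross cross' by simp
  finally show "prediction_error k S x w \<le> prediction_error k S x c" by simp
qed

text \<open>The weights in the Schur complement solve the normal equations, so they are optimal for
  prediction.\<close>

lemma det_gram_snoc_prediction_error: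
  assumes pd: "positive_definite_on I k"
    and nz: "Determinant.det (gram k xs) \<noteq> 0"
    and xs: "distinct xs" "set (xs @ [x]) \<subseteq> I"
  obtains w where
    "Determinant.det (gram k (xs @ [x])) =
       Determinant.det (gram k xs) * prediction_error k (set xs) x w"
    "\<And>c. prediction_error k (set xs) x w \<le> prediction_error k (set xs) x c"
proof -
  from det_gram_snoc[OF nz xs(1), of x] obtain w where w:
    "\<And>y. y \<in> set xs \<Longrightarrow> (\<Sum>z\<in>set xs. k y z * w z) = k y x"
    "Determinant.det (gram k (xs @ [x])) =
       Determinant.det (gram k xs) * (k x x - (\<Sum>z\<in>set xs. k x z * w z))" by blast
  have S: "insert x (set xs) \<subseteq> I" using xs by simp
  show thesis
    by (rule that[of w])
      (use prediction_error_minimum[OF pd finite_set S w(1)] w(2) in simp_all)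
qed

section \<open>Positivity of Gram determinants and Fischer's inequality\<close>

lemma det_gram_pos:
  assumes pd: "positive_definite_on I k"
  shows "distinct xs \<Longrightarrow> set xs \<subseteq> I \<Longrightarrow> 0 < Determinant.det (gram k xs)"
proof (induction xs rule: rev_induct)
  case (snoc x xs)
  then have IH: "0 < Determinant.det (gram k xs)" by simp
  obtain w where "Determinant.det (gram k (xs @ [x])) =
       Determinant.det (gram k xs) * prediction_error k (set xs) x w"
    by (rule det_gram_snoc_prediction_error[OF pd, of xs x]) (use IH snoc.prems in simp_all)
  moreover have "0 < prediction_error k (set xs) x w"
    using prediction_error_pos[OF pd, of "set xs"] snoc.prems by simp
  ultimately show ?case using IH by simp
qed simp

text \<open>Both ratios are least prediction errors, and a prediction from \<open>ys\<close> is also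
  one from \<open>xs\<close>, with weight 0 outside \<open>ys\<close>.\<close>

lemma det_gram_snoc_mono:
  assumes pd: "positive_definite_on I k"
    and xs: "distinct (xs @ [x])" "set (xs @ [x]) \<subseteq> I"
    and ys: "distinct ys" "set ys \<subseteq> set xs"
  shows "Determinant.det (gram k (xs @ [x])) / Determinant.det (gram k xs)
         \<le> Determinant.det (gram k (ys @ [x])) / Determinant.det (gram k ys)"
proof -
  have pos: "0 < Determinant.det (gram k xs)" "0 < Determinant.det (gram k ys)"
    using det_gram_pos[OF pd] xs ys by auto
  obtain w where w:
    "Determinant.det (gram k (xs @ [x])) =
       Determinant.det (gram k xs) * prediction_error k (set xs) x w"
    "\<And>c. prediction_error k (set xs) x w \<le> prediction_error k (set xs) x c"
    by (rule det_gram_snoc_prediction_error[OF pd, of xs x]) (use pos xs in simp_all)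
  obtain v where v:
    "Determinant.det (gram k (ys @ [x])) =
       Determinant.det (gram k ys) * prediction_error k (set ys) x v"
    by (rule det_gram_snoc_prediction_error[OF pd, of ys x]) (use pos xs ys in auto)
  define c where "c = (\<lambda>y. if y \<in> set ys then v y else 0)"
  have restr: "(\<Sum>y\<in>set xs. c y * h y) = (\<Sum>y\<in>set ys. v y * h y)" for h
    using ys(2) by (intro sum.mono_neutral_cong_right) (auto simp: c_def)
  have "prediction_error k (set xs) x c = prediction_error k (set ys) x v"
    unfolding prediction_error_def mult.assoc sum_distrib_left[symmetric] restr ..
  then show ?thesis using w v pos by (metis nonzero_mult_div_cancel_left less_irrefl)
qed

text \<open>Fischer's determinant inequality. Adjoining the points one at a time avoids any
  rearrangement of the matrix into blocks.\<close>

lemma det_gram_le_prod_classes: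
  assumes pd: "positive_definite_on I k" and C: "finite C"
  shows "distinct xs \<Longrightarrow> set xs \<subseteq> I \<Longrightarrow> g ` set xs \<subseteq> C \<Longrightarrow>
    Determinant.det (gram k xs) \<le> (\<Prod>r\<in>C. Determinant.det (gram k (filter (\<lambda>x. g x = r) xs)))"
proof (induction xs rule: rev_induct)
  case (snoc x xs)
  let ?D = "\<lambda>xs. Determinant.det (gram k xs)"
  let ?F = "\<lambda>r xs. filter (\<lambda>x. g x = r) xs"
  \<comment> \<open>The factor by which \<open>x\<close> multiplies the determinant of its own
    class.\<close>
  let ?q = "?D (?F (g x) xs @ [x]) / ?D (?F (g x) xs)"
  have pos: "0 < ?D zs" if "distinct zs" "set zs \<subseteq> I" for zs
    using det_gram_pos[OF pd] that .
  have posF: "0 < ?D (?F r xs)" for r using snoc.prems by (intro pos) auto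
  have q: "0 \<le> ?q" using posF[of "g x"] snoc.prems
    by (intro divide_nonneg_pos less_imp_le[OF pos]) auto
  have "?D (xs @ [x]) = ?D xs * (?D (xs @ [x]) / ?D xs)"
    using pos[of xs] snoc.prems by simp
  \<comment> \<open>The earlier members of the class of \<open>x\<close> are among all earlier
    points, so predicting from them alone is no better.\<close>
  also have "\<dots> \<le> ?D xs * ?q"
    using pos[of xs] snoc.prems
    by (intro mult_left_mono det_gram_snoc_mono[OF pd]) auto
  also have "\<dots> \<le> (\<Prod>r\<in>C. ?D (?F r xs)) * ?q"
    using snoc q by (intro mult_right_mono) auto
  \<comment> \<open>The denominator of \<open>?q\<close> cancels the old determinant of the class of
    \<open>x\<close>.\<close>
  also have "\<dots> = (\<Prod>r\<in>C - {g x}. ?D (?F r xs)) * ?D (?F (g x) xs @ [x])"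
    using snoc.prems posF[of "g x"] prod.remove[OF C, of "g x" "\<lambda>r. ?D (?F r xs)"] by simp
  also have "\<dots> = (\<Prod>r\<in>C. ?D (?F r (xs @ [x])))"
  proof -
    have "(\<Prod>r\<in>C - {g x}. ?D (?F r xs)) = (\<Prod>r\<in>C - {g x}. ?D (?F r (xs @ [x])))"
      by (intro prod.cong) auto
    then show ?thesis
      using snoc.prems prod.remove[OF C, of "g x" "\<lambda>r. ?D (?F r (xs @ [x]))"]
      by (simp add: mult.commute)
  qed
  finally show ?case .
qed simp

section \<open>Semidefiniteness of covariances\<close>

lemma integrable_normal_law_square:
  assumes "\<sigma> \<ge> 0"
  shows "integrable (normal_law \<mu> \<sigma>) (\<lambda>x. x\<^sup>2)"
proof (cases "\<sigma> = 0")
  case True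
  then show ?thesis
    by (auto intro!: integrableI_bounded simp: normal_law_def nn_integral_return)
next
  case False
  with assms have pos: "0 < \<sigma>" by simp
  \<comment> \<open>This writes \<open>x\<^sup>2\<close> as
    \<open>(x - \<mu>)\<^sup>2 + 2 * \<mu> * x - \<mu>\<^sup>2\<close>, whose terms are standard
    normal moments.\<close>
  have "integrable lborel (\<lambda>x. normal_density \<mu> \<sigma> x * (x - \<mu>)\<^sup>2
          + 2 * \<mu> * (normal_density \<mu> \<sigma> x * x) - \<mu>\<^sup>2 * normal_density \<mu> \<sigma> x)"
    using pos by (intro Bochner_Integration.integrable_add Bochner_Integration.integrable_diff
        integrable_mult_right integrable_normal_moment integrable_normal_moment_nz_1
        integrable_normal_density)
  also have "(\<lambda>x. normal_density \<mu> \<sigma> x * (x - \<mu>)\<^sup>2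
          + 2 * \<mu> * (normal_density \<mu> \<sigma> x * x) - \<mu>\<^sup>2 * normal_density \<mu> \<sigma> x)
      = (\<lambda>x. normal_density \<mu> \<sigma> x *\<^sub>R x\<^sup>2)"
    by (auto simp: algebra_simps power2_eq_square)
  finally show ?thesis
    using pos by (simp add: normal_law_def integrable_density)
qed

text \<open>The form is the second moment of a linear combination of the process. Thus the existence
  of the process makes the action-time kernel semidefinite, with no appeal to the Schur product
  theorem or to a spectral analysis of the periodic factor.\<close>

lemma gaussian_process_covariance_psd:
  assumes gp: "zero_mean_gaussian_process M S f k" and s: "s ` J \<subseteq> S"
  shows "0 \<le> (\<Sum>i\<in>J. \<Sum>j\<in>J. c i * c j * k (s i) (s j))"
proof -
  have meas: "f x \<in> borel_measurable M" if "x \<in> S" for x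
    using gp that by (simp add: zero_mean_gaussian_process_def)
  \<comment> \<open>Expanding the second moment requires integrable products, since a non-integrable
    function has integral 0 by convention. Square integrability comes from the normal
    marginals.\<close>
  have sq: "integrable M (\<lambda>\<omega>. (f x \<omega>)\<^sup>2)" if "x \<in> S" for x
  proof -
    have "\<forall>F c. finite F \<and> F \<subseteq> S \<longrightarrow>
        (\<exists>\<mu> \<sigma>. \<sigma> \<ge> 0 \<and> distr M borel (\<lambda>\<omega>. \<Sum>s\<in>F. c s * f s \<omega>) = normal_law \<mu> \<sigma>)"
      using gp by (simp add: zero_mean_gaussian_process_def)
    from this[rule_format, of "{x}" "\<lambda>_. 1"] that obtain \<mu> \<sigma>
      where "\<sigma> \<ge> 0" "distr M borel (\<lambda>\<omega>. \<Sum>s\<in>{x}. 1 * f s \<omega>) = normal_law \<mu> \<sigma>" by auto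
    then have "integrable (distr M borel (f x)) (\<lambda>x. x\<^sup>2)"
      using integrable_normal_law_square by simp
    then show ?thesis using integrable_distr[OF meas[OF that]] by blast
  qed
  have int: "integrable M (\<lambda>\<omega>. f x \<omega> * f y \<omega>)" if "x \<in> S" "y \<in> S" for x y
  proof (rule Bochner_Integration.integrable_bound)
    show "integrable M (\<lambda>\<omega>. (f x \<omega>)\<^sup>2 + (f y \<omega>)\<^sup>2)" using sq that by simp
    show "(\<lambda>\<omega>. f x \<omega> * f y \<omega>) \<in> borel_measurable M" using meas that by simp
    have "\<bar>u * v\<bar> \<le> u\<^sup>2 + v\<^sup>2" for u v :: real
      using sum_squares_bound[of "\<bar>u\<bar>" "\<bar>v\<bar>"] mult_nonneg_nonneg[of "\<bar>u\<bar>" "\<bar>v\<bar>"]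
      unfolding abs_mult power2_abs by linarith
    then show "AE \<omega> in M. norm (f x \<omega> * f y \<omega>) \<le> norm ((f x \<omega>)\<^sup>2 + (f y \<omega>)\<^sup>2)" by simp
  qed
  have "0 \<le> (\<integral>\<omega>. (\<Sum>i\<in>J. c i * f (s i) \<omega>)\<^sup>2 \<partial>M)" by simp
  also have "\<dots> = (\<integral>\<omega>. (\<Sum>i\<in>J. \<Sum>j\<in>J. c i * c j * (f (s i) \<omega> * f (s j) \<omega>)) \<partial>M)"
    by (simp only: power2_eq_square sum_product mult.commute mult.left_commute mult.assoc)
  also have "\<dots> = (\<Sum>i\<in>J. \<Sum>j\<in>J. c i * c j * (\<integral>\<omega>. f (s i) \<omega> * f (s j) \<omega> \<partial>M))"
    using s int by (simp add: image_subset_iff)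
  also have "\<dots> = (\<Sum>i\<in>J. \<Sum>j\<in>J. c i * c j * k (s i) (s j))"
    using gp s by (intro sum.cong) (auto simp: zero_mean_gaussian_process_def image_subset_iff)
  finally show ?thesis .
qed

text \<open>An enumeration of \<open>J\<close> reduces this to the initial segments in
  \<open>psd_kernel_on\<close>.\<close>

lemma psd_kernel_on_sum_nonneg:
  assumes psd: "psd_kernel_on A k" and J: "finite (J :: nat set)" "\<And>i. i \<in> J \<Longrightarrow> x i \<in> A"
  shows "0 \<le> (\<Sum>i\<in>J. \<Sum>j\<in>J. c i * c j * k (x i) (x j))"
proof -
  obtain h where h: "bij_betw h {..<card J} J"
    using ex_bij_betw_nat_finite[OF J(1)] by (auto simp: atLeast0LessThan)
  have "\<forall>i<card J. (x \<circ> h) i \<in> A" using h J(2) by (auto simp: bij_betw_def)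
  then have "0 \<le> (\<Sum>i<card J. \<Sum>j<card J. (c \<circ> h) i * (c \<circ> h) j * k ((x \<circ> h) i) ((x \<circ> h) j))"
    using psd unfolding psd_kernel_on_def by blast
  also have "\<dots> = (\<Sum>i\<in>J. \<Sum>j\<in>J. c i * c j * k (x i) (x j))"
    unfolding sum.reindex_bij_betw[OF h, symmetric] by simp
  finally show ?thesis .
qed

section \<open>Kernels with added noise and bounds on the information gain\<close>

text \<open>The identity contributes the sum of the squared coefficients, which makes a semidefinite
  form definite.\<close>

lemma positive_definite_on_identity_plus:
  assumes sym: "\<And>i j. i \<in> I \<Longrightarrow> j \<in> I \<Longrightarrow> k i j = k j i"
    and psd: "\<And>J c. finite J \<Longrightarrow> J \<subseteq> I \<Longrightarrow> 0 \<le> (\<Sum>i\<in>J. \<Sum>j\<in>J. c i * c j * k i j)"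
    and r: "0 \<le> r"
  shows "positive_definite_on I (\<lambda>i j. of_bool (i = j) + r * k i j)"
  unfolding positive_definite_on_def
proof (intro conjI ballI allI impI)
  show "of_bool (i = j) + r * k i j = of_bool (j = i) + r * k j i" if "i \<in> I" "j \<in> I" for i j
    using sym[OF that] by (simp only: eq_commute[of i])
next
  fix J and c :: "'a \<Rightarrow> real"
  assume J: "finite J \<and> J \<subseteq> I \<and> (\<exists>i\<in>J. c i \<noteq> 0)"
  then have "0 < (\<Sum>i\<in>J. (c i)\<^sup>2)" by (auto intro: sum_pos2)
  moreover have "(\<Sum>i\<in>J. \<Sum>j\<in>J. c i * c j * (of_bool (i = j) + r * k i j))
      = (\<Sum>i\<in>J. (c i)\<^sup>2) + r * (\<Sum>i\<in>J. \<Sum>j\<in>J. c i * c j * k i j)"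
    using J
    by (simp add: distrib_left sum.distrib sum_distrib_left mult_ac power2_eq_square of_bool_def
        if_distrib[of "\<lambda>t. _ * t"] sum.delta' cong: if_cong)
  ultimately show "0 < (\<Sum>i\<in>J. \<Sum>j\<in>J. c i * c j * (of_bool (i = j) + r * k i j))"
    using psd[of J c] J r by (simp add: add_pos_nonneg)
qed

text \<open>Equal inputs at distinct positions must stay distinct rows, so the Gram matrix is taken
  over the positions and not over the inputs.\<close>

abbreviation noisy_kernel :: "real \<Rightarrow> ('s \<Rightarrow> 's \<Rightarrow> real) \<Rightarrow> (nat \<Rightarrow> 's) \<Rightarrow> nat \<Rightarrow> nat \<Rightarrow> real" where
  "noisy_kernel \<sigma> k s \<equiv> (\<lambda>i j. of_bool (i = j) + inverse (\<sigma>\<^sup>2) * k (s (Suc i)) (s (Suc j)))"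

lemma info_gain_eq_gram:
  "info_gain \<sigma> n k s = 1 / 2 * ln (Determinant.det (gram (noisy_kernel \<sigma> k s) [0..<n]))"
proof -
  have "1\<^sub>m n + inverse (\<sigma>\<^sup>2) \<cdot>\<^sub>m kernel_matrix n k s = gram (noisy_kernel \<sigma> k s) [0..<n]"
    by (rule eq_matI) (auto simp: gram_def kernel_matrix_def)
  then show ?thesis by (simp add: info_gain_def)
qed

lemma positive_definite_on_noisy_psd_kernel:
  assumes psd: "psd_kernel_on A k" and a: "\<forall>i\<in>{1..n}. a i \<in> A"
  shows "positive_definite_on {..<n} (noisy_kernel \<sigma> k a)"
proof (rule positive_definite_on_identity_plus)
  show "k (a (Suc i)) (a (Suc j)) = k (a (Suc j)) (a (Suc i))"
    if "i \<in> {..<n}" "j \<in> {..<n}" for i j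
    using psd a that by (auto simp: psd_kernel_on_def)
  show "0 \<le> (\<Sum>i\<in>J. \<Sum>j\<in>J. c i * c j * k (a (Suc i)) (a (Suc j)))"
    if "finite J" "J \<subseteq> {..<n}" for J c
    using that a by (intro psd_kernel_on_sum_nonneg[OF psd, of J "\<lambda>i. a (Suc i)"]) auto
qed simp

text \<open>This is Hadamard's inequality, the case of Fischer's with singleton classes. It bounds
  the set whose supremum is \<open>max_info_gain_actions\<close>.\<close>

lemma info_gain_le:
  assumes psd: "psd_kernel_on A k" and bound: "\<And>x. x \<in> A \<Longrightarrow> k x x \<le> 1"
    and a: "\<forall>i\<in>{1..n}. a i \<in> A"
  shows "info_gain \<sigma> n k a \<le> 1 / 2 * ln ((1 + inverse (\<sigma>\<^sup>2)) ^ n)"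
proof -
  let ?k = "noisy_kernel \<sigma> k a"
  have pd: "positive_definite_on {..<n} ?k"
    by (rule positive_definite_on_noisy_psd_kernel[OF psd a])
  have "Determinant.det (gram ?k [0..<n])
      \<le> (\<Prod>r<n. Determinant.det (gram ?k (filter (\<lambda>x. id x = r) [0..<n])))"
    by (rule det_gram_le_prod_classes[OF pd]) auto
  also have "\<dots> = (\<Prod>r<n. ?k r r)"
  proof (rule prod.cong[OF refl])
    fix r assume "r \<in> {..<n}"
    then have "filter (\<lambda>x. id x = r) [0..<n] = [r]"
      by (induction n) (auto simp: less_Suc_eq filter_empty_conv)
    then show "Determinant.det (gram ?k (filter (\<lambda>x. id x = r) [0..<n])) = ?k r r" by simp
  qed
  also have "\<dots> \<le> (\<Prod>r<n. 1 + inverse (\<sigma>\<^sup>2))"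
  proof (rule prod_mono, intro conjI)
    fix r assume r: "r \<in> {..<n}"
    \<comment> \<open>A diagonal entry is a Gram determinant of size 1.\<close>
    have "0 < Determinant.det (gram ?k [r])" by (rule det_gram_pos[OF pd]) (use r in auto)
    then show "0 \<le> ?k r r" by simp
    have "k (a (Suc r)) (a (Suc r)) \<le> 1" using bound a r by auto
    then show "?k r r \<le> 1 + inverse (\<sigma>\<^sup>2)"
      using mult_left_mono[of _ 1 "inverse (\<sigma>\<^sup>2)"] by simp
  qed
  finally show ?thesis
    unfolding info_gain_eq_gram using det_gram_pos[OF pd, of "[0..<n]"] by (auto simp: atLeast0LessThan)
qed

section \<open>Residue classes of times modulo the period\<close>

lemma periodic_kernel_cong_eq_1:
  assumes "t mod \<tau> = t' mod \<tau>"
  shows "periodic_kernel l \<tau> t t' = 1"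
proof -
  have "int t mod int \<tau> = int t' mod int \<tau>"
    using assms by (simp flip: of_nat_mod)
  then have "int \<tau> dvd int t - int t'" by (simp only: mod_eq_dvd_iff)
  then obtain m where "int t - int t' = int \<tau> * m" by (rule dvdE)
  then have "real t - real t' = real \<tau> * of_int m"
    by (metis of_int_diff of_int_mult of_int_of_nat_eq)
  \<comment> \<open>The case \<tau> = 0 is covered because division by 0 yields 0.\<close>
  then have "pi * \<bar>real t - real t'\<bar> / real \<tau> = (if \<tau> = 0 then 0 else of_int \<bar>m\<bar>) * pi"
    by (simp add: abs_mult)
  then have "sin (pi * \<bar>real t - real t'\<bar> / real \<tau>) = 0"
    by (simp only: sin_times_pi_eq_0) simp
  then show ?thesis by (simp add: periodic_kernel_def)
qed

text \<open>Each stretch of \<tau> consecutive positions starting at a multiple of \<tau> contains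
  one member of the class; the induction splits off the last stretch.\<close>

lemma filter_mod_upt:
  assumes "r < \<tau>"
  shows "filter (\<lambda>t. t mod \<tau> = r) [0..<K * \<tau>] = map (\<lambda>i. i * \<tau> + r) [0..<K]"
proof (induction K)
  case (Suc K)
  let ?P = "\<lambda>t. t mod \<tau> = r"
  have "filter (\<lambda>i. i = r) [0..<\<tau>] = [r]"
    using assms by (induction \<tau>) (auto simp: less_Suc_eq filter_empty_conv)
  moreover have "filter (\<lambda>t. (t + K * \<tau>) mod \<tau> = r) [0..<\<tau>] = filter (\<lambda>i. i = r) [0..<\<tau>]"
    by (rule filter_cong) auto
  ultimately have last: "filter (\<lambda>t. (t + K * \<tau>) mod \<tau> = r) [0..<\<tau>] = [r]" by (simp only:)
  have "[0..<Suc K * \<tau>] = [0..<K * \<tau>] @ map (\<lambda>i. i + K * \<tau>) [0..<\<tau>]"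
    using upt_add_eq_append[of 0 "K * \<tau>" \<tau>] map_add_upt[of "K * \<tau>" \<tau>]
    by (simp only: mult_Suc add.commute)
  then have "filter ?P [0..<Suc K * \<tau>] = filter ?P [0..<K * \<tau>] @
      map (\<lambda>i. i + K * \<tau>) (filter (\<lambda>t. (t + K * \<tau>) mod \<tau> = r) [0..<\<tau>])"
    by (simp only: filter_append filter_map comp_def)
  then show ?case unfolding last Suc.IH by (simp add: add.commute)
qed simp

lemma info_gain_action_time_le:
  assumes pd: "positive_definite_on {..<K * \<tau>}
      (noisy_kernel \<sigma> (action_time_kernel kA l \<tau>) (\<lambda>t. (a t, t)))"
  shows "info_gain \<sigma> (K * \<tau>) (action_time_kernel kA l \<tau>) (\<lambda>t. (a t, t))
    \<le> (\<Sum>r<\<tau>. info_gain \<sigma> K kA (\<lambda>i. a (Suc ((i - 1) * \<tau> + r))))"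
proof -
  let ?k = "noisy_kernel \<sigma> (action_time_kernel kA l \<tau>) (\<lambda>t. (a t, t))"
  \<comment> \<open>The actions of class \<open>r\<close> in order of time: \<open>i - 1\<close>
    undoes the numbering of inputs from 1, and \<open>Suc\<close> turns a matrix position into a
    time.\<close>
  let ?b = "\<lambda>r i. a (Suc ((i - 1) * \<tau> + r))"
  let ?F = "\<lambda>r. filter (\<lambda>t. t mod \<tau> = r) [0..<K * \<tau>]"
  have block: "gram ?k (?F r) = gram (noisy_kernel \<sigma> kA (?b r)) [0..<K]" if r: "r < \<tau>" for r
  proof -
    have "periodic_kernel l \<tau> (Suc (i * \<tau> + r)) (Suc (j * \<tau> + r)) = 1" for i j
    proof (rule periodic_kernel_cong_eq_1)
      have "Suc (i * \<tau> + r) = Suc r + i * \<tau>" for i by simp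
      then show "Suc (i * \<tau> + r) mod \<tau> = Suc (j * \<tau> + r) mod \<tau>" by (metis mod_mult_self1)
    qed
    then show ?thesis
      using r unfolding filter_mod_upt[OF r] gram_map
      by (auto simp: action_time_kernel_def intro!: arg_cong2[where f = gram])
  qed
  have pos: "0 < Determinant.det (gram ?k xs)" if "distinct xs" "set xs \<subseteq> {..<K * \<tau>}" for xs
    using det_gram_pos[OF pd] that .
  have posF: "0 < Determinant.det (gram ?k (?F r))" for r by (rule pos) auto
  have "Determinant.det (gram ?k [0..<K * \<tau>]) \<le> (\<Prod>r<\<tau>. Determinant.det (gram ?k (?F r)))"
  proof (rule det_gram_le_prod_classes[OF pd])
    \<comment> \<open>For \<tau> = 0 the list is empty.\<close>
    show "(\<lambda>t. t mod \<tau>) ` set [0..<K * \<tau>] \<subseteq> {..<\<tau>}" by (cases "\<tau> = 0") auto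
  qed auto
  then have "ln (Determinant.det (gram ?k [0..<K * \<tau>]))
      \<le> ln (\<Prod>r<\<tau>. Determinant.det (gram ?k (?F r)))"
    using pos[of "[0..<K * \<tau>]"] by (auto simp: atLeast0LessThan)
  also have "\<dots> = (\<Sum>r<\<tau>. ln (Determinant.det (gram ?k (?F r))))"
    using posF by (intro ln_prod) (simp_all add: less_imp_neq[symmetric])
  also have "\<dots> = (\<Sum>r<\<tau>. ln (Determinant.det (gram (noisy_kernel \<sigma> kA (?b r)) [0..<K])))"
    using block by simp
  finally show ?thesis
    unfolding info_gain_eq_gram by (simp add: sum_divide_distrib[symmetric] divide_right_mono)
qed

theorem theorem2:
  fixes A :: "'a set" and kA :: "'a \<Rightarrow> 'a \<Rightarrow> real"
    and l \<sigma> :: real and \<tau> T K :: nat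
    and M :: "'w measure" and f :: "'a \<times> nat \<Rightarrow> 'w \<Rightarrow> real"
    and \<epsilon> y :: "nat \<Rightarrow> 'w \<Rightarrow> real" and a :: "nat \<Rightarrow> 'a"
  assumes "A \<noteq> {}"
    and "psd_kernel_on A kA"
    and "l > 0" and "\<sigma> > 0" and "\<tau> \<ge> 1" and "T \<ge> 1"
    and "real K = real T / real \<tau>"
    and "\<forall>s \<in> A \<times> {1..}. \<forall>s' \<in> A \<times> {1..}. action_time_kernel kA l \<tau> s s' \<le> 1"
    and "zero_mean_gaussian_process M (A \<times> {1..}) f (action_time_kernel kA l \<tau>)"
    and "\<forall>t\<in>{1..T}. distributed M lborel (\<epsilon> t) (normal_density 0 \<sigma>)"
    and "prob_space.indep_vars M (\<lambda>_. borel) \<epsilon> {1..T}"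
    and "prob_space.indep_set M
           (sets (vimage_algebra (space M) (\<lambda>\<omega>. \<lambda>s\<in>A \<times> {1..}. f s \<omega>)
              (Pi\<^sub>M (A \<times> {1..}) (\<lambda>_. borel))))
           (sets (vimage_algebra (space M) (\<lambda>\<omega>. \<lambda>t\<in>{1..T}. \<epsilon> t \<omega>)
              (Pi\<^sub>M {1..T} (\<lambda>_. borel))))"
    and "\<forall>t\<in>{1..T}. a t \<in> A"
    and "\<forall>t\<in>{1..T}. \<forall>\<omega>\<in>space M. y t \<omega> = f (a t, t) \<omega> + \<epsilon> t \<omega>"
  shows "max_info_gain_action_time A kA l \<tau> \<sigma> T
           \<le> (\<Sum>i\<in>{1..\<tau>}. max_info_gain_actions A kA \<sigma> K) \<and>
         (\<Sum>i\<in>{1..\<tau>}. max_info_gain_actions A kA \<sigma> K)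
           = real \<tau> * max_info_gain_actions A kA \<sigma> K"
proof -
  have "real T = real (K * \<tau>)" using assms(5,7) by simp
  then have T: "T = K * \<tau>" by (simp only: of_nat_eq_iff)
  \<comment> \<open>Comparing an input with itself makes the periodic factor 1, so the bound on the
    product kernel passes to \<open>kA\<close>.\<close>
  have diag: "kA x x \<le> 1" if "x \<in> A" for x
    using bspec[OF bspec[OF assms(8), of "(x, 1)"], of "(x, 1)"] that
    by (simp add: action_time_kernel_def periodic_kernel_def)
  have bdd: "bdd_above (info_gain \<sigma> K kA ` {b. \<forall>i\<in>{1..K}. b i \<in> A})"
    by (rule bdd_aboveI2, rule info_gain_le[OF assms(2) diag]) auto
  have le: "info_gain \<sigma> T (action_time_kernel kA l \<tau>) (\<lambda>t. (b t, t))
      \<le> real \<tau> * max_info_gain_actions A kA \<sigma> K" if b: "\<forall>t\<in>{1..T}. b t \<in> A" for b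
  proof -
    let ?k = "action_time_kernel kA l \<tau>"
    have "positive_definite_on {..<T} (noisy_kernel \<sigma> ?k (\<lambda>t. (b t, t)))"
    proof (rule positive_definite_on_identity_plus)
      show "?k (b (Suc i), Suc i) (b (Suc j), Suc j) = ?k (b (Suc j), Suc j) (b (Suc i), Suc i)"
        if "i \<in> {..<T}" "j \<in> {..<T}" for i j
      proof -
        have "kA (b (Suc i)) (b (Suc j)) = kA (b (Suc j)) (b (Suc i))"
          using assms(2) b that unfolding psd_kernel_on_def by auto
        then show ?thesis
          by (simp only: action_time_kernel_def periodic_kernel_def fst_conv snd_conv
              abs_minus_commute[of "real (Suc i)"])
      qed
      show "0 \<le> (\<Sum>i\<in>J. \<Sum>j\<in>J. c i * c j * ?k (b (Suc i), Suc i) (b (Suc j), Suc j))"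
        if "finite J" "J \<subseteq> {..<T}" for J c
        using that b
        by (intro gaussian_process_covariance_psd[OF assms(9), of "\<lambda>i. (b (Suc i), Suc i)"]) auto
    qed simp
    then have "info_gain \<sigma> T ?k (\<lambda>t. (b t, t))
        \<le> (\<Sum>r<\<tau>. info_gain \<sigma> K kA (\<lambda>i. b (Suc ((i - 1) * \<tau> + r))))"
      unfolding T by (rule info_gain_action_time_le)
    also have "\<dots> \<le> (\<Sum>r<\<tau>. max_info_gain_actions A kA \<sigma> K)"
      unfolding max_info_gain_actions_def
    proof (rule sum_mono, rule cSUP_upper[OF _ bdd], intro CollectI ballI)
      \<comment> \<open>The actions of each class are admissible, because their times lie between 1
        and \<open>T\<close>.\<close>
      fix r i assume r: "r \<in> {..<\<tau>}" and i: "i \<in> {1..K}"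
      then have "(i - 1) * \<tau> + r < (i - 1) * \<tau> + \<tau>" by simp
      also have "\<dots> = i * \<tau>" using i by (cases i) auto
      also have "\<dots> \<le> T" using i by (simp add: T)
      finally show "b (Suc ((i - 1) * \<tau> + r)) \<in> A" using b by simp
    qed
    finally show ?thesis by simp
  qed
  \<comment> \<open>As \<open>A\<close> is nonempty, admissible action sequences exist, so a uniform
    bound on their gains bounds the supremum.\<close>
  have "max_info_gain_action_time A kA l \<tau> \<sigma> T \<le> real \<tau> * max_info_gain_actions A kA \<sigma> K"
    unfolding max_info_gain_action_time_def
    using assms(1) le by (intro cSUP_least) auto
  then show ?thesis by simp
qed

end
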